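(* If $\mathcal N$ is a cartesian multicategory then, for every symmetric multicategory $\mathcal M$, $[\mathcal M,\mathcal N]$ is also cartesian in a natural way, namely with the pointwise cartesian structure $(\sigma\alpha)_A=\sigma(\alpha_A)$.
   Context: A cartesian structure on a multicategory $\mathcal N$ assigns, to every mapping $\sigma:\{1,\dots,n\}\to\{1,\dots,m\}$ and sequences of objects $A_1,\dots,A_n$ and $B_1,\dots,B_m$ with $B_{\sigma i}=A_i$, and every object $C$, a mapping $f\mapsto\sigma f$, $\mathcal N(A_1,\dots,A_n;C)\to\mathcal N(B_1,\dots,B_m;C)$, functorially ($\mathrm{id}f=f$, $\rho(\sigma f)=(\rho\sigma)f$) and compatibly with composition: (i) $f(\sigma_1f_1,\dots,\sigma_nf_n)=(\sigma_1+\cdots+\sigma_n)f(f_1,\dots,f_n)$, where $+$ is juxtaposition of mappings; (ii) $(\sigma f)(f_1,\dots,f_m)=\sigma'\big(f(f_{\sigma1},\dots,f_{\sigma n})\big)$, where $\sigma'$ maps the $k$-th place of the $i$-th block (the domain of $f_{\sigma i}$) to the $k$-th place of the $(\sigma i)$-th block of the concatenated domains of $f_1,\dots,f_m$. A symmetric structure is defined in the same way using only bijective $\sigma$, so a cartesian multicategory has an underlying symmetric multicategory. For symmetric multicategories $\mathcal M,\mathcal N$, the symmetric multicategory $[\mathcal M,\mathcal N]$ has as objects the symmetric functors $\mathcal M\to\mathcal N$; an arrow $\alpha:F_1,\dots,F_n\to F$ is a family of arrows $\alpha_A:F_1A,\dots,F_nA\to FA$ in $\mathcal N$ ($A\in\mathcal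 M$) such that $Ff(\alpha_{A_1},\dots,\alpha_{A_m})=\tau\,\alpha_A(F_1f,\dots,F_nf)$ for every $f:A_1,\dots,A_m\to A$ in $\mathcal M$, where $\tau$ is the evident permutation matching the two domains; composition and symmetric structure are pointwise. *)

theory Defs
  imports Main "HOL-Library.FuncSet"
begin

(* Each arrow determines its source list and its target, so the hom-sets are disjoint:
   N(A_1,...,A_n; C) is the set of f in arrs N with source N f = [A_1,...,A_n] and
   target N f = C.  The values of the operations on anything else are irrelevant. *)
record ('o, 'a) multicat =
  objs :: "'o set"
  arrs :: "'a set"
  source :: "'a \<Rightarrow> 'o list"
  target :: "'a \<Rightarrow> 'o"
  ident :: "'o \<Rightarrow> 'a"
  mcomp :: "'a \<Rightarrow> 'a list \<Rightarrow> 'a"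

definition composable :: "('o, 'a, 'x) multicat_scheme \<Rightarrow> 'a \<Rightarrow> 'a list \<Rightarrow> bool" where
  "composable N f gs \<longleftrightarrow> f \<in> arrs N \<and> set gs \<subseteq> arrs N \<and> map (target N) gs = source N f"

locale multicategory =
  fixes N :: "('o, 'a, 'x) multicat_scheme" (structure)
  assumes source_objs: "f \<in> arrs N \<Longrightarrow> set (source N f) \<subseteq> objs N"
    and target_objs: "f \<in> arrs N \<Longrightarrow> target N f \<in> objs N"
    and ident_arr: "A \<in> objs N \<Longrightarrow> ident N A \<in> arrs N"
    and source_ident: "A \<in> objs N \<Longrightarrow> source N (ident N A) = [A]"
    and target_ident: "A \<in> objs N \<Longrightarrow> target N (ident N A) = A"
    and mcomp_arr: "composable N f gs \<Longrightarrow> mcomp N f gs \<in> arrs N"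
    and source_mcomp: "composable N f gs \<Longrightarrow> source N (mcomp N f gs) = concat (map (source N) gs)"
    and target_mcomp: "composable N f gs \<Longrightarrow> target N (mcomp N f gs) = target N f"
    and ident_left: "f \<in> arrs N \<Longrightarrow> mcomp N (ident N (target N f)) [f] = f"
    and ident_right: "f \<in> arrs N \<Longrightarrow> mcomp N f (map (ident N) (source N f)) = f"
    and mcomp_assoc: "composable N f gs \<Longrightarrow> list_all2 (composable N) gs hss \<Longrightarrow>
      mcomp N (mcomp N f gs) (concat hss) = mcomp N f (map2 (mcomp N) gs hss)"

(* A mapping sigma : {0..<n} -> {0..<m} is represented by the list [sigma 0, ..., sigma (n-1)].
   act N sigma Bs f is the arrow (sigma f) with source Bs; the list Bs has to be given, since a
   non-surjective sigma and f do not determine it. *)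
record ('o, 'a) acted_multicat = "('o, 'a) multicat" +
  act :: "nat list \<Rightarrow> 'o list \<Rightarrow> 'a \<Rightarrow> 'a"

definition any_map :: "nat list \<Rightarrow> nat \<Rightarrow> bool" where
  "any_map \<sigma> m \<longleftrightarrow> set \<sigma> \<subseteq> {..<m}"

definition bij_map :: "nat list \<Rightarrow> nat \<Rightarrow> bool" where
  "bij_map \<sigma> m \<longleftrightarrow> bij_betw ((!) \<sigma>) {..<length \<sigma>} {..<m}"

definition map_comp :: "nat list \<Rightarrow> nat list \<Rightarrow> nat list" where
  "map_comp \<rho> \<sigma> = map ((!) \<rho>) \<sigma>"

(* Juxtaposition: ms lists the sizes of the codomains, which are concatenated. *)
definition juxt :: "nat list list \<Rightarrow> nat list \<Rightarrow> nat list" where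
  "juxt \<sigma>s ms = concat (map (\<lambda>i. map ((+) (sum_list (take i ms))) (\<sigma>s ! i)) [0..<length \<sigma>s])"

(* sigma' for blocks of sizes ls: the i-th block of the domain, of size ls ! (sigma i), is sent
   in order onto the (sigma i)-th block of the codomain {0..<sum_list ls}. *)
definition block_map :: "nat list \<Rightarrow> nat list \<Rightarrow> nat list" where
  "block_map \<sigma> ls =
    concat (map (\<lambda>j. let s = sum_list (take j ls) in [s..<s + ls ! j]) \<sigma>)"

(* The permutation tau from n blocks of size m to m blocks of size n, sending the j-th place of
   the i-th block to the i-th place of the j-th block. *)
definition transp_map :: "nat \<Rightarrow> nat \<Rightarrow> nat list" where
  "transp_map n m = concat (map (\<lambda>i. map (\<lambda>j. j * n + i) [0..<m]) [0..<n])"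

definition actable ::
  "(nat list \<Rightarrow> nat \<Rightarrow> bool) \<Rightarrow> ('o, 'a, 'x) multicat_scheme \<Rightarrow> nat list \<Rightarrow> 'o list \<Rightarrow> 'a \<Rightarrow> bool"
  where
  "actable P N \<sigma> Bs f \<longleftrightarrow>
    f \<in> arrs N \<and> set Bs \<subseteq> objs N \<and> P \<sigma> (length Bs) \<and> source N f = map ((!) Bs) \<sigma>"

locale acted_multicategory =
  multicategory N for N :: "('o, 'a, 'x) acted_multicat_scheme" (structure) +
  fixes P :: "nat list \<Rightarrow> nat \<Rightarrow> bool"
  assumes act_arr: "actable P N \<sigma> Bs f \<Longrightarrow> act N \<sigma> Bs f \<in> arrs N"
    and source_act: "actable P N \<sigma> Bs f \<Longrightarrow> source N (act N \<sigma> Bs f) = Bs"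
    and target_act: "actable P N \<sigma> Bs f \<Longrightarrow> target N (act N \<sigma> Bs f) = target N f"
    and act_id: "f \<in> arrs N \<Longrightarrow> act N [0..<length (source N f)] (source N f) f = f"
    and act_comp: "actable P N \<sigma> Bs f \<Longrightarrow> actable P N \<rho> Cs (act N \<sigma> Bs f) \<Longrightarrow>
      act N \<rho> Cs (act N \<sigma> Bs f) = act N (map_comp \<rho> \<sigma>) Cs f"
    and mcomp_act: "composable N f fs \<Longrightarrow> length \<sigma>s = length fs \<Longrightarrow> length Bss = length fs \<Longrightarrow>
      (\<And>i. i < length fs \<Longrightarrow> actable P N (\<sigma>s ! i) (Bss ! i) (fs ! i)) \<Longrightarrow>
      mcomp N f (map (\<lambda>i. act N (\<sigma>s ! i) (Bss ! i) (fs ! i)) [0..<length fs]) =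
      act N (juxt \<sigma>s (map length Bss)) (concat Bss) (mcomp N f fs)"
    and act_mcomp: "actable P N \<sigma> Bs f \<Longrightarrow> composable N (act N \<sigma> Bs f) fs \<Longrightarrow>
      mcomp N (act N \<sigma> Bs f) fs =
      act N (block_map \<sigma> (map (length \<circ> source N) fs)) (concat (map (source N) fs))
        (mcomp N f (map ((!) fs) \<sigma>))"

(* The two notions live on the same record.  The symmetric one constrains act only at bijections,
   so the underlying symmetric multicategory of a cartesian N is N itself, with the values of act
   at the other mappings ignored. *)
locale symmetric_multicategory = acted_multicategory N bij_map
  for N :: "('o, 'a, 'x) acted_multicat_scheme" (structure)

locale cartesian_multicategory = acted_multicategory N any_map
  for N :: "('o, 'a, 'x) acted_multicat_scheme" (structure)

lemma bij_map_imp_any_map: "bij_map \<sigma> m \<Longrightarrow> any_map \<sigma> m"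
  by (fastforce simp: bij_map_def any_map_def in_set_conv_nth dest: bij_betwE)

sublocale cartesian_multicategory \<subseteq> symmetric_multicategory
proof -
  have *: "actable any_map N \<sigma> Bs f" if "actable bij_map N \<sigma> Bs f" for \<sigma> Bs f
    using that bij_map_imp_any_map by (auto simp: actable_def)
  show "symmetric_multicategory N"
    by unfold_locales
      (auto intro!: act_arr source_act target_act act_id act_comp mcomp_act act_mcomp *)
qed

record ('o, 'a, 'p, 'b) mfunctor =
  on_obj :: "'o \<Rightarrow> 'p"
  on_arr :: "'a \<Rightarrow> 'b"

(* Extensionality makes two functors equal exactly when they agree on M. *)
definition symmetric_functor ::
  "('o, 'a, 'x) acted_multicat_scheme \<Rightarrow> ('p, 'b, 'y) acted_multicat_scheme \<Rightarrow>
   ('o, 'a, 'p, 'b) mfunctor \<Rightarrow> bool" where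
  "symmetric_functor M N F \<longleftrightarrow>
    on_obj F \<in> objs M \<rightarrow>\<^sub>E objs N \<and>
    on_arr F \<in> arrs M \<rightarrow>\<^sub>E arrs N \<and>
    (\<forall>f \<in> arrs M. source N (on_arr F f) = map (on_obj F) (source M f) \<and>
                   target N (on_arr F f) = on_obj F (target M f)) \<and>
    (\<forall>A \<in> objs M. on_arr F (ident M A) = ident N (on_obj F A)) \<and>
    (\<forall>f gs. composable M f gs \<longrightarrow>
      on_arr F (mcomp M f gs) = mcomp N (on_arr F f) (map (on_arr F) gs)) \<and>
    (\<forall>\<sigma> Bs f. actable bij_map M \<sigma> Bs f \<longrightarrow>
      on_arr F (act M \<sigma> Bs f) = act N \<sigma> (map (on_obj F) Bs) (on_arr F f))"

(* An arrow F_1,...,F_n -> F of [M,N] carries its source and target functors, which the family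
   alone need not determine. *)
record ('o, 'a, 'p, 'b) mtrans =
  tsource :: "('o, 'a, 'p, 'b) mfunctor list"
  ttarget :: "('o, 'a, 'p, 'b) mfunctor"
  component :: "'o \<Rightarrow> 'b"

definition natural_family ::
  "('o, 'a, 'x) acted_multicat_scheme \<Rightarrow> ('p, 'b, 'y) acted_multicat_scheme \<Rightarrow>
   ('o, 'a, 'p, 'b) mtrans \<Rightarrow> bool" where
  "natural_family M N \<alpha> \<longleftrightarrow>
    (\<forall>F \<in> set (tsource \<alpha>). symmetric_functor M N F) \<and>
    symmetric_functor M N (ttarget \<alpha>) \<and>
    component \<alpha> \<in> objs M \<rightarrow>\<^sub>E arrs N \<and>
    (\<forall>A \<in> objs M. source N (component \<alpha> A) = map (\<lambda>F. on_obj F A) (tsource \<alpha>) \<and>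
                   target N (component \<alpha> A) = on_obj (ttarget \<alpha>) A) \<and>
    (\<forall>f \<in> arrs M.
      mcomp N (on_arr (ttarget \<alpha>) f) (map (component \<alpha>) (source M f)) =
      act N (transp_map (length (tsource \<alpha>)) (length (source M f)))
        (concat (map (\<lambda>A. map (\<lambda>F. on_obj F A) (tsource \<alpha>)) (source M f)))
        (mcomp N (component \<alpha> (target M f)) (map (\<lambda>F. on_arr F f) (tsource \<alpha>))))"

(* The multicategory [M,N].  Its objects and arrows involve act M and act N at bijections only;
   act at an arbitrary mapping is given by the pointwise formula, meaningful at bijections when N
   is symmetric and at all mappings when N is cartesian. *)
definition internal_hom ::
  "('o, 'a, 'x) acted_multicat_scheme \<Rightarrow> ('p, 'b, 'y) acted_multicat_scheme \<Rightarrow>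
   (('o, 'a, 'p, 'b) mfunctor, ('o, 'a, 'p, 'b) mtrans) acted_multicat" where
  "internal_hom M N = \<lparr>
    objs = {F. symmetric_functor M N F},
    arrs = {\<alpha>. natural_family M N \<alpha>},
    source = tsource,
    target = ttarget,
    ident = (\<lambda>F. \<lparr>tsource = [F], ttarget = F,
                  component = (\<lambda>A \<in> objs M. ident N (on_obj F A))\<rparr>),
    mcomp = (\<lambda>\<alpha> \<beta>s. \<lparr>tsource = concat (map tsource \<beta>s), ttarget = ttarget \<alpha>,
                  component = (\<lambda>A \<in> objs M.
                    mcomp N (component \<alpha> A) (map (\<lambda>\<beta>. component \<beta> A) \<beta>s))\<rparr>),
    act = (\<lambda>\<sigma> Gs \<alpha>. \<lparr>tsource = Gs, ttarget = ttarget \<alpha>,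
                  component = (\<lambda>A \<in> objs M.
                    act N \<sigma> (map (\<lambda>G. on_obj G A) Gs) (component \<alpha> A))\<rparr>)\<rparr>"

end

theory Submission
  imports Defs
begin

text \<open>
  All axioms for $[M,N]$ hold pointwise once the identities, composites and $\sigma\alpha$ are known
  to be natural. Naturality of a composite and of $\sigma\alpha$ is computed with the axioms of $N$
  and comes down to an equality between two mappings of places. A mapping $\sigma$ is determined by
  the list \<open>map ((!) xs) \<sigma>\<close> for a single list \<open>xs\<close> of distinct labels, and the effect of
  \<open>juxt\<close>, \<open>block_map\<close> and \<open>transp_map\<close> on such lists is transparent, so no index arithmetic
  is needed for these equalities.
\<close>

section \<open>Mappings acting on lists\<close>

text \<open>The obstacle is that naturality of a composite or of \<open>\<sigma>\<alpha>\<close>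
  produces an iterated action, while the definition asks for one transposition. Moving every action
  outward and fusing with \<open>act_comp\<close> leaves two identities. For composition, exchanging
  a pair \<open>(i, q)\<close> with \<open>j\<close> can be done in two stages: first
  \<open>q\<close> with \<open>j\<close> inside each block \<open>i\<close>, then \<open>i\<close>
  with \<open>j\<close>, moving whole blocks. For the action, a transposition commutes with applying
  \<sigma> to one of its two coordinates. The labels sit on the codomain, so a \<sigma> that is not
  bijective merely repeats or omits labels when they are pulled back. Since \<open>N\<close> is
  cartesian, its axioms apply to a permutation as soon as \<open>any_map\<close> bounds its values;
  bijectivity never has to be established.\<close>

lemma map_nth_inject:
  assumes "distinct xs" "any_map \<sigma> (length xs)" "any_map \<rho> (length xs)"
    and "map ((!) xs) \<sigma> = map ((!) xs) \<rho>"
  shows "\<sigma> = \<rho>"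
proof -
  have "inj_on ((!) xs) {..<length xs}"
    using assms(1) by (simp add: inj_on_nth)
  then have "inj_on ((!) xs) (set \<sigma> \<union> set \<rho>)"
    by (rule inj_on_subset) (use assms(2,3) in \<open>auto simp: any_map_def\<close>)
  then show ?thesis
    using assms(4) map_inj_on by blast
qed

text \<open>A list is a function on its places, so this is associativity of composition of
  functions. It lets labels be pulled back through a composite one factor at a time.\<close>

lemma map_nth_map_comp:
  assumes "any_map \<sigma> (length \<rho>)"
  shows "map ((!) xs) (map_comp \<rho> \<sigma>) = map ((!) (map ((!) xs) \<rho>)) \<sigma>"
  using assms by (auto simp: map_comp_def any_map_def)

lemma any_map_map_comp:
  assumes "any_map \<sigma> (length \<rho>)" "any_map \<rho> k"
  shows "any_map (map_comp \<rho> \<sigma>) k"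
  using assms by (force simp: map_comp_def any_map_def subset_iff)

section \<open>Concatenated blocks: offsets, juxtaposition and block maps\<close>

lemma nth_concat_add:
  assumes "i < length xss" "k < length (xss ! i)"
  shows "concat xss ! (sum_list (take i (map length xss)) + k) = xss ! i ! k"
  using assms
proof (induction xss arbitrary: i)
  case (Cons xs xss)
  then show ?case
    by (cases i) (auto simp: nth_append add.assoc)
qed simp

lemma sum_list_take_add_less:
  fixes ls :: "nat list"
  assumes "i < length ls" "k < ls ! i"
  shows "sum_list (take i ls) + k < sum_list ls"
  using assms
proof (induction ls arbitrary: i)
  case (Cons l ls)
  then show ?case
    by (cases i) (auto simp: add.assoc)
qed simp

text \<open>The offset that \<open>juxt\<close> adds to the i-th mapping is the total length of the
  earlier blocks, hence the position where \<open>xss ! i\<close> starts in the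
  concatenation.\<close>

lemma map_nth_juxt:
  assumes "length \<sigma>s = length xss"
    and "\<And>i. i < length xss \<Longrightarrow> any_map (\<sigma>s ! i) (length (xss ! i))"
  shows "map ((!) (concat xss)) (juxt \<sigma>s (map length xss)) =
    concat (map (\<lambda>i. map ((!) (xss ! i)) (\<sigma>s ! i)) [0..<length xss])"
  unfolding juxt_def map_concat map_map assms(1)
  by (rule arg_cong[of _ _ concat])
     (use assms(2) in \<open>fastforce simp: any_map_def nth_concat_add intro!: map_cong\<close>)

lemma any_map_juxt:
  assumes "length \<sigma>s = length ms" "\<And>i. i < length ms \<Longrightarrow> any_map (\<sigma>s ! i) (ms ! i)"
  shows "any_map (juxt \<sigma>s ms) (sum_list ms)"
  using assms by (fastforce simp: any_map_def juxt_def intro!: sum_list_take_add_less)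

text \<open>Indexing by the entries of \<open>bs\<close> instead of their positions fits families
  given by functors, objects or transformations, and keeps the later computations free of
  indices.\<close>

lemma map_nth_juxt_map:
  assumes "\<And>b. b \<in> set bs \<Longrightarrow> any_map (s b) (length (x b))"
  shows "map ((!) (concat (map x bs))) (juxt (map s bs) (map (length \<circ> x) bs)) =
    concat (map (\<lambda>b. map ((!) (x b)) (s b)) bs)"
proof -
  have "map (\<lambda>i. map ((!) (map x bs ! i)) (map s bs ! i)) [0..<length bs] =
      map (\<lambda>b. map ((!) (x b)) (s b)) bs"
    by (rule nth_equalityI) auto
  then show ?thesis
    using map_nth_juxt[of "map s bs" "map x bs"] assms by simp
qed

lemma any_map_juxt_map:
  assumes "\<And>b. b \<in> set bs \<Longrightarrow> any_map (s b) (m b)"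
  shows "any_map (juxt (map s bs) (map m bs)) (sum_list (map m bs))"
  by (rule any_map_juxt) (use assms in auto)

text \<open>The interval chosen for a value \<open>j\<close> of \<sigma> consists of exactly the
  places of \<open>xss ! j\<close>, so whole blocks are copied in the order given by
  \<sigma>.\<close>

lemma map_nth_block_map:
  assumes "any_map \<sigma> (length xss)"
  shows "map ((!) (concat xss)) (block_map \<sigma> (map length xss)) = concat (map ((!) xss) \<sigma>)"
  unfolding block_map_def map_concat map_map
  by (rule arg_cong[of _ _ concat])
     (use assms in \<open>auto simp: any_map_def Let_def nth_concat_add intro!: nth_equalityI\<close>)

lemma any_map_block_map:
  assumes "any_map \<sigma> (length ls)"
  shows "any_map (block_map \<sigma> ls) (sum_list ls)"
proof -
  have "k < sum_list ls"
    if "j \<in> set \<sigma>" "k < sum_list (take j ls) + ls ! j" "sum_list (take j ls) \<le> k" for j k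
    using sum_list_take_add_less[of j ls "k - sum_list (take j ls)"] that assms
    by (auto simp: any_map_def)
  then show ?thesis
    by (auto simp: any_map_def block_map_def Let_def)
qed

section \<open>Transposition of a rectangular table\<close>

lemma length_transp_map: "length (transp_map n m) = n * m"
  by (simp add: transp_map_def length_concat comp_def sum_list_triv)

lemma any_map_transp_map: "any_map (transp_map n m) (m * n)"
proof -
  have "j * n + i < m * n" if "i < n" "j < m" for i j
  proof -
    have "j * n + i < Suc j * n" using that by simp
    also have "\<dots> \<le> m * n" using that by (intro mult_le_mono1) simp
    finally show ?thesis .
  qed
  then show ?thesis
    by (auto simp: any_map_def transp_map_def)
qed

lemma nth_concat_rows:
  assumes "j < length ys" "i < length xs"
  shows "concat (map (\<lambda>y. map (\<lambda>x. g x y) xs) ys) ! (j * length xs + i) = g (xs ! i) (ys ! j)"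
  using assms
proof (induction ys arbitrary: j)
  case (Cons y ys)
  then show ?case
    by (cases j) (auto simp: nth_append add.assoc)
qed simp

text \<open>Place \<open>j * n + i\<close> holds the i-th entry of the j-th row, so reading through
  the transposition goes column by column. Transposing thus becomes an exchange of two nested
  \<open>map\<close>s.\<close>

lemma map_nth_transp_map:
  assumes "n = length xs" "m = length ys"
  shows "map ((!) (concat (map (\<lambda>y. map (\<lambda>x. g x y) xs) ys))) (transp_map n m) =
    concat (map (\<lambda>x. map (g x) ys) xs)"
proof -
  have "map (\<lambda>i. map (\<lambda>j. g (xs ! i) (ys ! j)) [0..<length ys]) [0..<length xs] =
      map (\<lambda>x. map (g x) ys) xs"
    by (auto intro!: nth_equalityI)
  moreover have "map (\<lambda>i. map (\<lambda>j. concat (map (\<lambda>y. map (\<lambda>x. g x y) xs) ys) ! (j * length xs + i))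
      [0..<length ys]) [0..<length xs] =
      map (\<lambda>i. map (\<lambda>j. g (xs ! i) (ys ! j)) [0..<length ys]) [0..<length xs]"
    by (auto simp: nth_concat_rows)
  ultimately show ?thesis
    unfolding transp_map_def map_concat map_map assms by (simp add: comp_def)
qed

section \<open>The two identities behind naturality\<close>

lemma concat_concat: "concat (concat xsss) = concat (map concat xsss)"
  by (induction xsss) auto

text \<open>The first component separates different blocks and \<open>f y\<close> separates within a
  block. This makes the lists of labels distinct.\<close>

lemma distinct_concat_Pair:
  assumes "distinct ys" "\<And>y. y \<in> set ys \<Longrightarrow> distinct (f y)"
  shows "distinct (concat (map (\<lambda>y. map (Pair y) (f y)) ys))"
  using assms by (induction ys) (auto simp: distinct_map inj_on_def)

lemma length_concat_const:
  "(\<And>y. y \<in> set ys \<Longrightarrow> length (f y) = n) \<Longrightarrow> length (concat (map f ys)) = length ys * n"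
  by (induction ys) auto

text \<open>Label a place of the codomain by \<open>(j, i, q)\<close>: \<open>j\<close> is an
  argument of \<open>f\<close>, \<open>i\<close> selects a transformation, \<open>q\<close> one of
  its source functors. The juxtaposition takes the order i, q, j to i, j, q, and the block map takes
  i, j, q to j, i, q. Together they exchange the pair \<open>(i, q)\<close> with
  \<open>j\<close>.\<close>

lemma transp_map_juxt:
  fixes k :: "'b \<Rightarrow> nat"
  shows "map_comp (block_map (transp_map (length bs) m) (concat (map (\<lambda>_. map k bs) [0..<m])))
      (juxt (map (\<lambda>b. transp_map (k b) m) bs) (map (\<lambda>b. m * k b) bs)) =
    transp_map (sum_list (map k bs)) m"
proof -
  \<comment> \<open>The list \<open>bs\<close> may have repeated entries, so positions serve as
    labels in its place.\<close>
  define js where "js = [0..<length bs]"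
  define k' where "k' i = k (bs ! i)" for i
  have bs: "bs = map ((!) bs) js"
    by (simp add: js_def map_nth)
  have k: "map k bs = map k' js"
    "map (\<lambda>b. transp_map (k b) m) bs = map (\<lambda>i. transp_map (k' i) m) js"
    "map (\<lambda>b. m * k b) bs = map (\<lambda>i. m * k' i) js"
    by (subst bs, simp add: k'_def)+
  have len: "length bs = length js"
    by (simp add: js_def)
  \<comment> \<open>Triples associate to the right, so \<open>(j, i, q)\<close> is also
    \<open>(j, l)\<close> with \<open>l\<close> in \<open>ls\<close>. The same list of labels is
    therefore both the table with entries \<open>(j, l)\<close>, needed for the single
    transposition, and the concatenation of the blocks in \<open>xss\<close>, needed for the block
    map.\<close>
  define ls where "ls = concat (map (\<lambda>i. map (Pair i) [0..<k' i]) js)"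
  define xss where
    "xss = concat (map (\<lambda>j. map (\<lambda>i. map (\<lambda>q. (j, i, q)) [0..<k' i]) js) [0..<m])"
  define xs where "xs = concat (map (\<lambda>j. map (Pair j) ls) [0..<m])"
  have xs_xss: "xs = concat xss"
    by (simp add: xs_def xss_def ls_def map_concat concat_concat comp_def)
  have lens: "concat (map (\<lambda>_. map k' js) [0..<m]) = map length xss"
    by (simp add: xss_def map_concat comp_def)
  have length_ls: "length ls = sum_list (map k' js)"
    by (simp add: ls_def length_concat comp_def)
  have length_xs: "length xs = m * sum_list (map k' js)"
    by (subst xs_def, subst length_concat_const[where n = "length ls"]) (auto simp: length_ls)
  have length_xss: "length xss = m * length js"
    by (subst xss_def, subst length_concat_const[where n = "length js"]) auto
  have sum_xss: "sum_list (map length xss) = length xs"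
    by (simp add: xs_xss length_concat)
  define B where "B = block_map (transp_map (length js) m) (map length xss)"
  define J where "J = juxt (map (\<lambda>i. transp_map (k' i) m) js) (map (\<lambda>i. m * k' i) js)"
  have \<tau>: "any_map (transp_map (length js) m) (length xss)"
    by (simp add: length_xss any_map_transp_map)
  have B: "map ((!) xs) B = concat (map (\<lambda>i. concat (map (\<lambda>j. map (\<lambda>q. (j, i, q)) [0..<k' i]) [0..<m])) js)"
  proof -
    have "map ((!) xss) (transp_map (length js) m) =
        concat (map (\<lambda>i. map (\<lambda>j. map (\<lambda>q. (j, i, q)) [0..<k' i]) [0..<m]) js)"
      unfolding xss_def by (rule map_nth_transp_map) simp_all
    then show ?thesis
      unfolding B_def xs_xss map_nth_block_map[OF \<tau>] by (simp add: concat_concat comp_def)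
  qed
  have len_block: "length \<circ> (\<lambda>i. concat (map (\<lambda>j. map (\<lambda>q. (j, i, q)) [0..<k' i]) [0..<m])) =
      (\<lambda>i. m * k' i)"
    by (rule ext) (simp add: length_concat comp_def sum_list_triv)
  have "any_map J (sum_list (map (\<lambda>i. m * k' i) js))"
    unfolding J_def by (rule any_map_juxt_map) (rule any_map_transp_map)
  \<comment> \<open>Pulling labels back preserves length, so the length of \<open>B\<close> is read
    off its list of labels.\<close>
  moreover have "length B = sum_list (map (\<lambda>i. m * k' i) js)"
    using arg_cong[OF B, of length] by (simp add: length_concat comp_def sum_list_triv)
  ultimately have J: "any_map J (length B)"
    by simp
  have "map ((!) xs) (map_comp B J) = map ((!) (map ((!) xs) B)) J"
    by (rule map_nth_map_comp[OF J])
  also have "\<dots> = concat (map (\<lambda>i. map ((!) (concat (map (\<lambda>j. map (\<lambda>q. (j, i, q)) [0..<k' i]) [0..<m])))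
      (transp_map (k' i) m)) js)"
    unfolding B J_def len_block[symmetric]
    by (rule map_nth_juxt_map) (simp add: length_concat comp_def sum_list_triv any_map_transp_map)
  also have "\<dots> = concat (map (\<lambda>i. concat (map (\<lambda>q. map (\<lambda>j. (j, i, q)) [0..<m]) [0..<k' i])) js)"
    by (subst map_nth_transp_map) auto
  also have "\<dots> = concat (map (\<lambda>l. map (\<lambda>j. (j, l)) [0..<m]) ls)"
    by (simp add: ls_def map_concat concat_concat comp_def)
  also have "\<dots> = map ((!) xs) (transp_map (length ls) m)"
    unfolding xs_def by (rule map_nth_transp_map[symmetric]) simp_all
  finally have "map ((!) xs) (map_comp B J) = map ((!) xs) (transp_map (length ls) m)" .
  moreover have "distinct xs"
    unfolding xs_def ls_def js_def by (intro distinct_concat_Pair) (auto simp: distinct_map)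
  moreover have "any_map (map_comp B J) (length xs)"
    using any_map_map_comp[OF J] any_map_block_map[of _ "map length xss"] \<tau> sum_xss
    by (simp add: B_def)
  moreover have "any_map (transp_map (length ls) m) (length xs)"
    by (simp add: length_xs length_ls any_map_transp_map)
  ultimately have "map_comp B J = transp_map (length ls) m"
    by (intro map_nth_inject)
  then show ?thesis
    unfolding B_def J_def length_ls lens[symmetric]
    by (simp only: len k)
qed

text \<open>Both sides send the j-th place of the i-th block to the place of index
  \<open>\<sigma> ! i\<close> in the j-th block: one transposes first and then applies \<sigma>
  inside each of the \<open>m\<close> blocks, the other moves whole blocks by \<sigma> and then
  transposes.\<close>

lemma juxt_transp_map:
  assumes "any_map \<sigma> l"
  shows "map_comp (juxt (map (\<lambda>_. \<sigma>) [0..<m]) (map (\<lambda>_. l) [0..<m])) (transp_map (length \<sigma>) m) =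
    map_comp (transp_map l m) (block_map \<sigma> (map (\<lambda>_. m) [0..<l]))"
proof -
  define xss where "xss = map (\<lambda>j. map (Pair j) [0..<l]) [0..<m]"
  define xs where "xs = concat xss"
  define J where "J = juxt (map (\<lambda>_. \<sigma>) [0..<m]) (map (\<lambda>_. l) [0..<m])"
  define B where "B = block_map \<sigma> (map (\<lambda>_. m) [0..<l])"
  have length_xs: "length xs = m * l"
    by (simp add: xs_def xss_def length_concat comp_def sum_list_triv)
  have J_xs: "map ((!) xs) J = concat (map (\<lambda>j. map (\<lambda>i. (j, i)) \<sigma>) [0..<m])"
  proof -
    have length_row: "length \<circ> (\<lambda>j::nat. map (Pair j) [0..<l]) = (\<lambda>_. l)" by auto
    have "map ((!) xs) J = concat (map (\<lambda>j. map ((!) (map (Pair j) [0..<l])) \<sigma>) [0..<m])"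
      unfolding xs_def xss_def J_def length_row[symmetric]
      by (rule map_nth_juxt_map) (simp add: assms)
    also have "(\<lambda>j. map ((!) (map (Pair j) [0..<l])) \<sigma>) = (\<lambda>j::nat. map (\<lambda>i. (j, i)) \<sigma>)"
      using assms by (auto simp: any_map_def fun_eq_iff)
    finally show ?thesis .
  qed
  have J: "any_map J (m * l)"
    using any_map_juxt_map[of "[0..<m]" "\<lambda>_. \<sigma>" "\<lambda>_. l"] assms by (simp add: J_def sum_list_triv)
  have B: "any_map B (l * m)"
    using any_map_block_map[of \<sigma> "map (\<lambda>_. m) [0..<l]"] assms by (simp add: B_def sum_list_triv)
  have length_J: "length J = m * length \<sigma>"
    using arg_cong[OF J_xs, of length] by (simp add: length_concat comp_def sum_list_triv)
  have \<tau>J: "any_map (transp_map (length \<sigma>) m) (length J)"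
    by (simp add: length_J any_map_transp_map)
  have B\<tau>: "any_map B (length (transp_map l m))"
    using B by (simp add: length_transp_map)
  have "map ((!) xs) (map_comp J (transp_map (length \<sigma>) m)) =
      concat (map (\<lambda>i. map (\<lambda>j. (j, i)) [0..<m]) \<sigma>)"
    unfolding map_nth_map_comp[OF \<tau>J] J_xs by (rule map_nth_transp_map) simp_all
  moreover have "map ((!) xs) (map_comp (transp_map l m) B) =
      concat (map (\<lambda>i. map (\<lambda>j. (j, i)) [0..<m]) \<sigma>)"
  proof -
    let ?yss = "map (\<lambda>i. map (\<lambda>j. (j, i)) [0..<m]) [0..<l]"
    have "map ((!) xs) (transp_map l m) = concat ?yss"
      unfolding xs_def xss_def by (rule map_nth_transp_map) simp_all
    then have "map ((!) xs) (map_comp (transp_map l m) B) = map ((!) (concat ?yss)) B"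
      by (simp only: map_nth_map_comp[OF B\<tau>])
    also have "\<dots> = concat (map ((!) ?yss) \<sigma>)"
      using map_nth_block_map[of \<sigma> ?yss] assms by (simp add: B_def comp_def)
    also have "map ((!) ?yss) \<sigma> = map (\<lambda>i. map (\<lambda>j. (j, i)) [0..<m]) \<sigma>"
      using assms by (auto simp: any_map_def)
    finally show ?thesis .
  qed
  moreover have "distinct xs"
    unfolding xs_def xss_def by (intro distinct_concat_Pair) auto
  moreover have "any_map (map_comp J (transp_map (length \<sigma>) m)) (length xs)"
    unfolding length_xs by (rule any_map_map_comp[OF \<tau>J J])
  moreover have "any_map (map_comp (transp_map l m) B) (length xs)"
    unfolding length_xs by (rule any_map_map_comp[OF B\<tau> any_map_transp_map])
  ultimately show ?thesis
    unfolding J_def B_def by (intro map_nth_inject[of xs]) simp_all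
qed

section \<open>Composition and action along indexed families\<close>

text \<open>With both families indexed by one list, the \<open>map2\<close> of the axiom disappears
  and the inner composites can be rewritten under a single \<open>map\<close>.\<close>

lemma (in multicategory) mcomp_assoc_map:
  assumes "composable N f (map g bs)" "\<And>b. b \<in> set bs \<Longrightarrow> composable N (g b) (h b)"
  shows "mcomp N (mcomp N f (map g bs)) (concat (map h bs)) =
    mcomp N f (map (\<lambda>b. mcomp N (g b) (h b)) bs)"
proof -
  have "list_all2 (composable N) (map g bs) (map h bs)"
    using assms(2) by (simp add: list_all2_conv_all_nth)
  moreover have "map2 (mcomp N) (map g bs) (map h bs) = map (\<lambda>b. mcomp N (g b) (h b)) bs"
    by (induction bs) auto
  ultimately show ?thesis
    using mcomp_assoc[OF assms(1)] by simp
qed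

lemma (in multicategory) composable_mcomp:
  assumes "composable N f (map g bs)" "\<And>b. b \<in> set bs \<Longrightarrow> composable N (g b) (h b)"
  shows "composable N f (map (\<lambda>b. mcomp N (g b) (h b)) bs)"
  using assms by (auto simp: composable_def mcomp_arr target_mcomp comp_def cong: map_cong)

lemma (in multicategory) composable_concat:
  assumes "composable N f (map g bs)" "\<And>b. b \<in> set bs \<Longrightarrow> composable N (g b) (h b)"
  shows "composable N (mcomp N f (map g bs)) (concat (map h bs))"
proof -
  have "map (target N) (h b) = source N (g b)" if "b \<in> set bs" for b
    using assms(2)[OF that] by (simp add: composable_def)
  moreover have "set (h b) \<subseteq> arrs N" if "b \<in> set bs" for b
    using assms(2)[OF that] by (simp add: composable_def)
  ultimately show ?thesis
    unfolding composable_def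
    using mcomp_arr[OF assms(1)] source_mcomp[OF assms(1)]
    by (auto simp: map_concat comp_def cong: map_cong)
qed

lemma (in acted_multicategory) mcomp_act_map:
  assumes "composable N f (map g bs)" "\<And>b. b \<in> set bs \<Longrightarrow> actable P N (s b) (B b) (g b)"
  shows "mcomp N f (map (\<lambda>b. act N (s b) (B b) (g b)) bs) =
    act N (juxt (map s bs) (map (length \<circ> B) bs)) (concat (map B bs)) (mcomp N f (map g bs))"
proof -
  have "map (\<lambda>b. act N (s b) (B b) (g b)) bs =
      map (\<lambda>i. act N (map s bs ! i) (map B bs ! i) (map g bs ! i)) [0..<length bs]"
    by (auto intro!: nth_equalityI)
  then show ?thesis
    using mcomp_act[OF assms(1), of "map s bs" "map B bs"] assms(2) by simp
qed

lemma (in acted_multicategory) composable_act_iff: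
  assumes "actable P N \<sigma> Bs f"
  shows "composable N (act N \<sigma> Bs f) fs \<longleftrightarrow> set fs \<subseteq> arrs N \<and> map (target N) fs = Bs"
  using act_arr[OF assms] source_act[OF assms] by (simp add: composable_def)

section \<open>Typing of iterated actions\<close>

context multicategory
begin

text \<open>Supplies the typing that \<open>act_comp\<close> demands. The rules for pulling back
  labels apply with objects of \<open>N\<close> as labels, and so compute the source of the
  composite.\<close>

lemma actable_juxt_map:
  assumes "composable N f (map g bs)" "\<And>b. b \<in> set bs \<Longrightarrow> actable any_map N (s b) (B b) (g b)"
  shows "actable any_map N (juxt (map s bs) (map (length \<circ> B) bs)) (concat (map B bs))
    (mcomp N f (map g bs))"
proof -
  have "any_map (s b) (length (B b))" "source N (g b) = map ((!) (B b)) (s b)"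
    "set (B b) \<subseteq> objs N" if "b \<in> set bs" for b
    using assms(2)[OF that] by (simp_all add: actable_def)
  then show ?thesis
    using any_map_juxt_map[of bs s "length \<circ> B"] map_nth_juxt_map[of bs s B]
      source_mcomp[OF assms(1)] mcomp_arr[OF assms(1)]
    by (auto simp: actable_def length_concat comp_def cong: map_cong)
qed

lemma composable_map_nth:
  assumes "actable any_map N \<sigma> Bs f" "set fs \<subseteq> arrs N" "map (target N) fs = Bs"
  shows "composable N f (map ((!) fs) \<sigma>)"
  using assms by (fastforce simp: composable_def actable_def any_map_def)

text \<open>The typing of the right-hand side of \<open>act_mcomp\<close>: reading the blocks of
  sources through \<sigma> gives the sources of the arrows selected by \<sigma>.\<close>

lemma actable_block_map:
  assumes "actable any_map N \<sigma> Bs f" "set fs \<subseteq> arrs N" "map (target N) fs = Bs"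
  shows "actable any_map N (block_map \<sigma> (map (length \<circ> source N) fs)) (concat (map (source N) fs))
    (mcomp N f (map ((!) fs) \<sigma>))"
proof -
  have comp: "composable N f (map ((!) fs) \<sigma>)"
    using assms by (rule composable_map_nth)
  have \<sigma>: "any_map \<sigma> (length (map (source N) fs))"
    using assms by (auto simp: actable_def)
  then have "map (source N) (map ((!) fs) \<sigma>) = map ((!) (map (source N) fs)) \<sigma>"
    by (auto simp: any_map_def)
  then have "source N (mcomp N f (map ((!) fs) \<sigma>)) = concat (map ((!) (map (source N) fs)) \<sigma>)"
    by (simp only: source_mcomp[OF comp])
  moreover have source_fs: "set (concat (map (source N) fs)) \<subseteq> objs N"
    using assms(2) source_objs by fastforce
  ultimately show ?thesis
    using map_nth_block_map[OF \<sigma>] any_map_block_map[of \<sigma> "map (length \<circ> source N) fs"] \<sigma>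
      mcomp_arr[OF comp] source_fs
    by (simp add: actable_def length_concat)
qed

end

section \<open>The cartesian multicategory of functors\<close>

lemma internal_hom_sel [simp]:
  "objs (internal_hom M N) = {F. symmetric_functor M N F}"
  "arrs (internal_hom M N) = {\<alpha>. natural_family M N \<alpha>}"
  "source (internal_hom M N) = tsource"
  "target (internal_hom M N) = ttarget"
  "ident (internal_hom M N) F = \<lparr>tsource = [F], ttarget = F,
     component = (\<lambda>A \<in> objs M. ident N (on_obj F A))\<rparr>"
  "mcomp (internal_hom M N) \<alpha> \<beta>s = \<lparr>tsource = concat (map tsource \<beta>s), ttarget = ttarget \<alpha>,
     component = (\<lambda>A \<in> objs M. mcomp N (component \<alpha> A) (map (\<lambda>\<beta>. component \<beta> A) \<beta>s))\<rparr>"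
  "act (internal_hom M N) \<sigma> Gs \<alpha> = \<lparr>tsource = Gs, ttarget = ttarget \<alpha>,
     component = (\<lambda>A \<in> objs M. act N \<sigma> (map (\<lambda>G. on_obj G A) Gs) (component \<alpha> A))\<rparr>"
  by (simp_all add: internal_hom_def)

text \<open>Components are extensional, so agreement on \<open>X\<close>, taken to be the objects of
  \<open>M\<close>, suffices. This turns an axiom of \<open>N\<close> at each object into an
  equality of arrows of the internal hom.\<close>

lemma mtrans_eqI:
  assumes "tsource \<alpha> = tsource \<beta>" "ttarget \<alpha> = ttarget \<beta>"
    and "component \<alpha> \<in> extensional X" "component \<beta> \<in> extensional X"
    and "\<And>A. A \<in> X \<Longrightarrow> component \<alpha> A = component \<beta> A"
  shows "\<alpha> = (\<beta> :: ('o, 'a, 'p, 'b) mtrans)"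
  using assms(1,2) extensionalityI[OF assms(3-5)] by (intro mtrans.equality) auto

section \<open>Functors, natural families and evaluation at an object\<close>

lemma symmetric_functor_obj:
  "symmetric_functor M N F \<Longrightarrow> A \<in> objs M \<Longrightarrow> on_obj F A \<in> objs N"
  by (auto simp: symmetric_functor_def)

lemma symmetric_functor_arr:
  assumes "symmetric_functor M N F" "f \<in> arrs M"
  shows "on_arr F f \<in> arrs N" "source N (on_arr F f) = map (on_obj F) (source M f)"
    "target N (on_arr F f) = on_obj F (target M f)"
  using assms by (auto simp: symmetric_functor_def)

lemma natural_family_functor:
  assumes "natural_family M N \<alpha>"
  shows "F \<in> set (tsource \<alpha>) \<Longrightarrow> symmetric_functor M N F" "symmetric_functor M N (ttarget \<alpha>)"
  using assms by (auto simp: natural_family_def)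

lemma natural_family_component:
  assumes "natural_family M N \<alpha>" "A \<in> objs M"
  shows "component \<alpha> A \<in> arrs N"
    "source N (component \<alpha> A) = map (\<lambda>F. on_obj F A) (tsource \<alpha>)"
    "target N (component \<alpha> A) = on_obj (ttarget \<alpha>) A"
  using assms by (auto simp: natural_family_def)

lemma natural_family_extensional:
  "natural_family M N \<alpha> \<Longrightarrow> component \<alpha> \<in> extensional (objs M)"
  by (auto simp: natural_family_def PiE_def)

lemma natural_family_natural:
  "natural_family M N \<alpha> \<Longrightarrow> f \<in> arrs M \<Longrightarrow>
    mcomp N (on_arr (ttarget \<alpha>) f) (map (component \<alpha>) (source M f)) =
    act N (transp_map (length (tsource \<alpha>)) (length (source M f)))
      (concat (map (\<lambda>A. map (\<lambda>F. on_obj F A) (tsource \<alpha>)) (source M f)))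
      (mcomp N (component \<alpha> (target M f)) (map (\<lambda>F. on_arr F f) (tsource \<alpha>)))"
  by (simp add: natural_family_def)

lemma composable_internal_hom_iff:
  "composable (internal_hom M N) \<alpha> \<beta>s \<longleftrightarrow>
    natural_family M N \<alpha> \<and> (\<forall>\<beta> \<in> set \<beta>s. natural_family M N \<beta>) \<and> map ttarget \<beta>s = tsource \<alpha>"
  by (auto simp: composable_def)

lemma actable_internal_hom_iff:
  "actable P (internal_hom M N) \<sigma> Gs \<alpha> \<longleftrightarrow>
    natural_family M N \<alpha> \<and> (\<forall>G \<in> set Gs. symmetric_functor M N G) \<and> P \<sigma> (length Gs) \<and>
    tsource \<alpha> = map ((!) Gs) \<sigma>"
  by (auto simp: actable_def)

lemma composable_component:
  assumes "composable (internal_hom M N) \<alpha> \<beta>s" "A \<in> objs M"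
  shows "composable N (component \<alpha> A) (map (\<lambda>\<beta>. component \<beta> A) \<beta>s)"
proof -
  have "map (\<lambda>\<beta>. on_obj (ttarget \<beta>) A) \<beta>s = map (\<lambda>F. on_obj F A) (map ttarget \<beta>s)"
    by simp
  also have "map ttarget \<beta>s = tsource \<alpha>"
    using assms(1) by (simp add: composable_internal_hom_iff)
  finally show ?thesis
    using assms natural_family_component[where M = M and N = N and A = A]
    by (auto simp: composable_internal_hom_iff composable_def[of N] comp_def cong: map_cong)
qed

lemma actable_component:
  assumes "actable any_map (internal_hom M N) \<sigma> Gs \<alpha>" "A \<in> objs M"
  shows "actable any_map N \<sigma> (map (\<lambda>G. on_obj G A) Gs) (component \<alpha> A)"
proof -
  have "i < length Gs" if "i \<in> set \<sigma>" for i
    using assms(1) that by (auto simp: actable_internal_hom_iff any_map_def)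
  then show ?thesis
    using assms natural_family_component[where M = M and N = N and A = A]
      symmetric_functor_obj[where M = M and N = N and A = A]
    by (auto simp: actable_internal_hom_iff actable_def[of _ N])
qed

lemma composable_functor_components:
  assumes "natural_family M N \<alpha>" "f \<in> arrs M" "set (source M f) \<subseteq> objs M"
  shows "composable N (on_arr (ttarget \<alpha>) f) (map (component \<alpha>) (source M f))"
  using assms natural_family_component[OF assms(1)]
    symmetric_functor_arr[OF natural_family_functor(2)[OF assms(1)] assms(2)]
  by (auto simp: composable_def subset_iff)

text \<open>The arrow \<open>h\<close> is arbitrary because it will also be a component of a family
  whose naturality is still to be proved.\<close>

lemma composable_arr_functors:
  assumes "h \<in> arrs N" "source N h = map (\<lambda>F. on_obj F (target M f)) Fs"
    and "\<And>F. F \<in> set Fs \<Longrightarrow> symmetric_functor M N F" "f \<in> arrs M"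
  shows "composable N h (map (\<lambda>F. on_arr F f) Fs)"
  using assms symmetric_functor_arr[where M = M and N = N and f = f] by (auto simp: composable_def)

section \<open>Naturality of identities, composites and reindexed families\<close>

locale functor_multicategory =
  M: symmetric_multicategory M + N: acted_multicategory N any_map
  for M :: "('o, 'a, 'x) acted_multicat_scheme" and N :: "('p, 'b, 'y) acted_multicat_scheme"
begin

text \<open>The objects \<open>on_obj F A\<close> form a table. The composite lists it functor by
  functor, the required source object by object, and the transposition mediates.\<close>

lemma actable_transp_map:
  assumes "h \<in> arrs N" "source N h = map (\<lambda>F. on_obj F (target M f)) Fs"
    and "\<And>F. F \<in> set Fs \<Longrightarrow> symmetric_functor M N F" "f \<in> arrs M"
  shows "actable any_map N (transp_map (length Fs) (length (source M f)))
    (concat (map (\<lambda>A. map (\<lambda>F. on_obj F A) Fs) (source M f))) (mcomp N h (map (\<lambda>F. on_arr F f) Fs))"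
proof -
  have comp: "composable N h (map (\<lambda>F. on_arr F f) Fs)"
    using assms by (rule composable_arr_functors)
  have "source N (mcomp N h (map (\<lambda>F. on_arr F f) Fs)) =
      concat (map (\<lambda>F. map (on_obj F) (source M f)) Fs)"
    using N.source_mcomp[OF comp] symmetric_functor_arr(2)[OF assms(3) assms(4)]
    by (simp add: comp_def cong: map_cong)
  moreover have "set (concat (map (\<lambda>A. map (\<lambda>F. on_obj F A) Fs) (source M f))) \<subseteq> objs N"
    using M.source_objs[OF assms(4)] symmetric_functor_obj[OF assms(3)] by auto
  moreover have "length (concat (map (\<lambda>A. map (\<lambda>F. on_obj F A) Fs) (source M f))) =
      length (source M f) * length Fs"
    by (rule length_concat_const) simp
  ultimately show ?thesis
    unfolding actable_def
    using N.mcomp_arr[OF comp] any_map_transp_map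
    by (simp add: map_nth_transp_map)
qed

text \<open>With a single source functor the transposition is an identity mapping, so naturality
  reduces to the unit laws and \<open>act_id\<close>.\<close>

lemma natural_family_ident:
  assumes F: "symmetric_functor M N F"
  shows "natural_family M N (ident (internal_hom M N) F)"
proof -
  have "mcomp N (on_arr F f) (map (\<lambda>A\<in>objs M. ident N (on_obj F A)) (source M f)) =
      act N (transp_map 1 (length (source M f))) (concat (map (\<lambda>A. [on_obj F A]) (source M f)))
       (mcomp N (ident N (on_obj F (target M f))) [on_arr F f])" if f: "f \<in> arrs M" for f
  proof -
    note Ff = symmetric_functor_arr[OF F f]
    have "map (\<lambda>A\<in>objs M. ident N (on_obj F A)) (source M f) = map (ident N) (source N (on_arr F f))"
      using M.source_objs[OF f] by (auto simp: Ff)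
    moreover have "transp_map 1 (length (source M f)) = [0..<length (source N (on_arr F f))]"
      by (simp add: transp_map_def Ff map_nth)
    moreover have "concat (map (\<lambda>A. [on_obj F A]) (source M f)) = source N (on_arr F f)"
      by (simp add: Ff)
    ultimately show ?thesis
      using N.ident_right[OF Ff(1)] N.ident_left[OF Ff(1)] N.act_id[OF Ff(1)]
      by (simp only: Ff(3))
  qed
  then show ?thesis
    using F M.target_objs symmetric_functor_obj[OF F]
    by (auto simp: natural_family_def N.ident_arr N.source_ident N.target_ident)
qed

text \<open>Associativity exposes the naturality of \<alpha>, whose transposition leaves the
  composite as a block map by \<open>act_mcomp\<close>. Associativity again exposes the naturality
  of each entry of \<open>\<beta>s\<close>, whose transpositions leave as a juxtaposition by
  \<open>mcomp_act\<close>. The two mappings fuse by \<open>transp_map_juxt\<close>.\<close>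

lemma natural_family_mcomp:
  assumes comp: "composable (internal_hom M N) \<alpha> \<beta>s"
  shows "natural_family M N (mcomp (internal_hom M N) \<alpha> \<beta>s)"
proof -
  define \<gamma> where "\<gamma> = mcomp (internal_hom M N) \<alpha> \<beta>s"
  have \<alpha>: "natural_family M N \<alpha>" and \<beta>: "\<And>\<beta>. \<beta> \<in> set \<beta>s \<Longrightarrow> natural_family M N \<beta>"
    and tsource_\<alpha>: "tsource \<alpha> = map ttarget \<beta>s"
    using comp by (auto simp: composable_internal_hom_iff)
  have tsource_\<gamma>: "tsource \<gamma> = concat (map tsource \<beta>s)" and ttarget_\<gamma>: "ttarget \<gamma> = ttarget \<alpha>"
    by (simp_all add: \<gamma>_def)
  have \<gamma>: "component \<gamma> A = mcomp N (component \<alpha> A) (map (\<lambda>\<beta>. component \<beta> A) \<beta>s)"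
    if "A \<in> objs M" for A
    using that by (simp add: \<gamma>_def)
  note compN = composable_component[OF comp]
  have functors: "symmetric_functor M N G" if "G \<in> set (tsource \<gamma>)" for G
    using that natural_family_functor(1)[OF \<beta>] by (auto simp: tsource_\<gamma>)
  have source_\<gamma>: "source N (component \<gamma> A) = map (\<lambda>F. on_obj F A) (tsource \<gamma>)"
    if "A \<in> objs M" for A
    using N.source_mcomp[OF compN[OF that]] natural_family_component(2)[OF \<beta> that] that
    by (simp add: \<gamma> tsource_\<gamma> map_concat comp_def cong: map_cong)
  have \<gamma>_arr: "component \<gamma> A \<in> arrs N" if "A \<in> objs M" for A
    using N.mcomp_arr[OF compN[OF that]] that by (simp add: \<gamma>)
  have natural: "mcomp N (on_arr (ttarget \<gamma>) f) (map (component \<gamma>) (source M f)) =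
      act N (transp_map (length (tsource \<gamma>)) (length (source M f)))
        (concat (map (\<lambda>A. map (\<lambda>F. on_obj F A) (tsource \<gamma>)) (source M f)))
        (mcomp N (component \<gamma> (target M f)) (map (\<lambda>F. on_arr F f) (tsource \<gamma>)))"
    if f: "f \<in> arrs M" for f
  proof -
    define As where "As = source M f"
    define A where "A = target M f"
    define Ff where "Ff = on_arr (ttarget \<alpha>) f"
    define n where "n = length \<beta>s"
    define m where "m = length As"
    define k where "k \<beta> = length (tsource \<beta>)" for \<beta> :: "('o, 'a, 'p, 'b) mtrans"
    have k: "k = length \<circ> tsource"
      by (simp add: k_def fun_eq_iff)
    define X where "X = mcomp N (component \<alpha> A) (map (\<lambda>\<beta>. on_arr (ttarget \<beta>) f) \<beta>s)"
    define Y where "Y \<beta> = mcomp N (component \<beta> A) (map (\<lambda>G. on_arr G f) (tsource \<beta>))"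
      for \<beta> :: "('o, 'a, 'p, 'b) mtrans"
    define \<tau> where "\<tau> = transp_map n m"
    define Bs where "Bs = concat (map (\<lambda>B. map (\<lambda>\<beta>. on_obj (ttarget \<beta>) B) \<beta>s) As)"
    define Cs where "Cs \<beta> = concat (map (\<lambda>B. map (\<lambda>G. on_obj G B) (tsource \<beta>)) As)"
      for \<beta> :: "('o, 'a, 'p, 'b) mtrans"
    define hs where "hs = concat (map (\<lambda>B. map (\<lambda>\<beta>. component \<beta> B) \<beta>s) As)"
    have As: "B \<in> objs M" if "B \<in> set As" for B
      using that M.source_objs[OF f] by (auto simp: As_def)
    have A: "A \<in> objs M"
      unfolding A_def using f by (rule M.target_objs)
    have comp_F: "composable N (on_arr (ttarget \<beta>) f) (map (component \<beta>) As)"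
      if "natural_family M N \<beta>" for \<beta>
      unfolding As_def using that f M.source_objs[OF f] by (rule composable_functor_components)
    have natural_\<alpha>: "mcomp N Ff (map (component \<alpha>) As) = act N \<tau> Bs X"
      using natural_family_natural[OF \<alpha> f]
      by (simp add: Ff_def As_def \<tau>_def n_def m_def Bs_def X_def A_def tsource_\<alpha> comp_def)
    have natural_\<beta>: "mcomp N (on_arr (ttarget \<beta>) f) (map (component \<beta>) As) =
        act N (transp_map (k \<beta>) m) (Cs \<beta>) (Y \<beta>)" if "\<beta> \<in> set \<beta>s" for \<beta>
      using natural_family_natural[OF \<beta>[OF that] f]
      by (simp add: As_def k_def m_def Cs_def Y_def A_def)
    have comp_X: "composable N (component \<alpha> A) (map (\<lambda>\<beta>. on_arr (ttarget \<beta>) f) \<beta>s)"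
      using composable_arr_functors[of "component \<alpha> A" N M f "map ttarget \<beta>s"]
        natural_family_component[OF \<alpha> A] natural_family_functor(2)[OF \<beta>] f
      by (auto simp: tsource_\<alpha> A_def comp_def)
    have actable_X: "actable any_map N \<tau> Bs X"
      using actable_transp_map[of "component \<alpha> A" f "map ttarget \<beta>s"]
        natural_family_component[OF \<alpha> A] natural_family_functor(2)[OF \<beta>] f
      by (auto simp: tsource_\<alpha> A_def \<tau>_def n_def m_def Bs_def X_def As_def comp_def)
    have comp_Y: "composable N (component \<beta> A) (map (\<lambda>G. on_arr G f) (tsource \<beta>))"
      if "\<beta> \<in> set \<beta>s" for \<beta>
      by (rule composable_arr_functors[where M = M])
         (use natural_family_component[OF \<beta>[OF that] A] natural_family_functor(1)[OF \<beta>[OF that]] f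
           in \<open>auto simp: A_def\<close>)
    have actable_Y: "actable any_map N (transp_map (k \<beta>) m) (Cs \<beta>) (Y \<beta>)"
      if "\<beta> \<in> set \<beta>s" for \<beta>
      unfolding k_def m_def Cs_def Y_def As_def
      by (rule actable_transp_map)
         (use natural_family_component[OF \<beta>[OF that] A] natural_family_functor(1)[OF \<beta>[OF that]] f
           in \<open>auto simp: A_def\<close>)
    \<comment> \<open>Seen from the other side of the naturality of \<alpha>, the outer arrow is
      \<open>Ff\<close> composed with components of \<alpha>, where composability is clear.\<close>
    have comp_hs: "composable N (act N \<tau> Bs X) hs"
      unfolding natural_\<alpha>[symmetric] hs_def Ff_def
      by (rule N.composable_concat[OF comp_F[OF \<alpha>]]) (rule compN[OF As])
    then have hs: "set hs \<subseteq> arrs N" "map (target N) hs = Bs"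
      using N.composable_act_iff[OF actable_X] by auto
    \<comment> \<open>The order object by object suits the composite under \<open>Ff\<close>; after
      \<tau> the order is transformation by transformation, which suits the composite
      \<open>X\<close>.\<close>
    have hs_\<tau>: "map ((!) hs) \<tau> = concat (map (\<lambda>\<beta>. map (component \<beta>) As) \<beta>s)"
      unfolding hs_def \<tau>_def by (rule map_nth_transp_map) (simp_all add: n_def m_def)
    have source_hs: "map (source N) hs =
        concat (map (\<lambda>B. map (\<lambda>\<beta>. map (\<lambda>G. on_obj G B) (tsource \<beta>)) \<beta>s) As)"
      using natural_family_component(2)[OF \<beta> As]
      by (simp add: hs_def map_concat comp_def cong: map_cong)
    have lengths_hs: "map (length \<circ> source N) hs = concat (map (\<lambda>_. map k \<beta>s) [0..<m])"
    proof -
      have "map (length \<circ> source N) hs = map length (map (source N) hs)"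
        by simp
      also have "\<dots> = concat (map (\<lambda>_. map k \<beta>s) As)"
        by (simp add: source_hs map_concat comp_def k)
      also have "map (\<lambda>_. map k \<beta>s) As = map (\<lambda>_. map k \<beta>s) [0..<m]"
        by (simp add: m_def map_replicate_const)
      finally show ?thesis .
    qed
    have concat_source_hs: "concat (map (source N) hs) =
        concat (map (\<lambda>B. map (\<lambda>G. on_obj G B) (tsource \<gamma>)) As)"
      by (simp add: source_hs tsource_\<gamma> concat_concat map_concat comp_def)
    define \<beta>\<tau> where "\<beta>\<tau> = block_map \<tau> (map (length \<circ> source N) hs)"
    define J where
      "J = juxt (map (\<lambda>\<beta>. transp_map (k \<beta>) m) \<beta>s) (map (length \<circ> Cs) \<beta>s)"
    have length_Cs: "length \<circ> Cs = (\<lambda>\<beta>. m * k \<beta>)"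
      by (rule ext) (simp add: Cs_def k_def m_def length_concat comp_def sum_list_triv)
    have comp_\<alpha>Y: "composable N (component \<alpha> A) (map Y \<beta>s)"
      unfolding Y_def by (rule N.composable_mcomp[OF compN[OF A] comp_Y])
    have "mcomp N Ff (map (component \<gamma>) As) =
        mcomp N Ff (map (\<lambda>B. mcomp N (component \<alpha> B) (map (\<lambda>\<beta>. component \<beta> B) \<beta>s)) As)"
      using \<gamma>[OF As] by (simp cong: map_cong)
    also have "\<dots> = mcomp N (mcomp N Ff (map (component \<alpha>) As)) hs"
      unfolding hs_def Ff_def
      by (rule N.mcomp_assoc_map[symmetric, OF comp_F[OF \<alpha>]]) (rule compN[OF As])
    also have "\<dots> = act N \<beta>\<tau> (concat (map (source N) hs)) (mcomp N X (map ((!) hs) \<tau>))"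
      unfolding natural_\<alpha> \<beta>\<tau>_def by (rule N.act_mcomp[OF actable_X comp_hs])
    also have step: "mcomp N X (map ((!) hs) \<tau>) =
        act N J (concat (map Cs \<beta>s)) (mcomp N (component \<alpha> A) (map Y \<beta>s))"
    proof -
      have "mcomp N X (map ((!) hs) \<tau>) = mcomp N (component \<alpha> A)
          (map (\<lambda>\<beta>. mcomp N (on_arr (ttarget \<beta>) f) (map (component \<beta>) As)) \<beta>s)"
        unfolding X_def hs_\<tau> by (rule N.mcomp_assoc_map[OF comp_X]) (rule comp_F[OF \<beta>])
      also have "\<dots> = mcomp N (component \<alpha> A)
          (map (\<lambda>\<beta>. act N (transp_map (k \<beta>) m) (Cs \<beta>) (Y \<beta>)) \<beta>s)"
        using natural_\<beta> by (simp cong: map_cong)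
      also have "\<dots> = act N J (concat (map Cs \<beta>s)) (mcomp N (component \<alpha> A) (map Y \<beta>s))"
        unfolding J_def by (rule N.mcomp_act_map[OF comp_\<alpha>Y actable_Y])
      finally show ?thesis .
    qed
    also have "act N \<beta>\<tau> (concat (map (source N) hs))
        (act N J (concat (map Cs \<beta>s)) (mcomp N (component \<alpha> A) (map Y \<beta>s))) =
      act N (map_comp \<beta>\<tau> J) (concat (map (source N) hs)) (mcomp N (component \<alpha> A) (map Y \<beta>s))"
    proof (rule N.act_comp)
      show "actable any_map N J (concat (map Cs \<beta>s)) (mcomp N (component \<alpha> A) (map Y \<beta>s))"
        unfolding J_def by (rule N.actable_juxt_map[OF comp_\<alpha>Y actable_Y])
      \<comment> \<open>Read backwards, \<open>step\<close> replaces the inner action by the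
        composite that \<open>act_mcomp\<close> produced, whose typing is known.\<close>
      show "actable any_map N \<beta>\<tau> (concat (map (source N) hs))
          (act N J (concat (map Cs \<beta>s)) (mcomp N (component \<alpha> A) (map Y \<beta>s)))"
        unfolding \<beta>\<tau>_def step[symmetric] by (rule N.actable_block_map[OF actable_X hs])
    qed
    also have "map_comp \<beta>\<tau> J = transp_map (length (tsource \<gamma>)) m"
    proof -
      have "length (tsource \<gamma>) = sum_list (map k \<beta>s)"
        by (simp add: tsource_\<gamma> length_concat k)
      then show ?thesis
        unfolding \<beta>\<tau>_def J_def \<tau>_def n_def lengths_hs length_Cs by (simp only: transp_map_juxt)
    qed
    also have "mcomp N (component \<alpha> A) (map Y \<beta>s) =
        mcomp N (component \<gamma> A) (map (\<lambda>G. on_arr G f) (tsource \<gamma>))"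
      using N.mcomp_assoc_map[OF compN[OF A] comp_Y] A
      by (simp add: Y_def[abs_def] \<gamma> tsource_\<gamma> map_concat comp_def)
    finally show ?thesis
      by (simp add: concat_source_hs Ff_def ttarget_\<gamma> As_def A_def m_def)
  qed
  have "component \<gamma> \<in> objs M \<rightarrow>\<^sub>E arrs N"
    using \<gamma>_arr by (auto simp: \<gamma>_def)
  moreover have "target N (component \<gamma> A) = on_obj (ttarget \<gamma>) A" if "A \<in> objs M" for A
    using N.target_mcomp[OF compN[OF that]] natural_family_component(3)[OF \<alpha> that] that
    by (simp add: \<gamma> ttarget_\<gamma>)
  ultimately have "natural_family M N \<gamma>"
    using functors natural_family_functor(2)[OF \<alpha>] source_\<gamma> natural
    by (simp add: natural_family_def ttarget_\<gamma>)
  then show ?thesis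
    by (simp only: \<gamma>_def)
qed

text \<open>Both sides reduce to an action on the same arrow \<open>X\<close>. On the left the
  copies of \<sigma> leave by \<open>mcomp_act\<close> and meet the transposition of \<alpha>; on
  the right \<sigma> leaves by \<open>act_mcomp\<close> below the new transposition. The mappings
  agree by \<open>juxt_transp_map\<close>.\<close>

lemma natural_family_act:
  assumes act: "actable any_map (internal_hom M N) \<sigma> Gs \<alpha>"
  shows "natural_family M N (act (internal_hom M N) \<sigma> Gs \<alpha>)"
proof -
  define \<gamma> where "\<gamma> = act (internal_hom M N) \<sigma> Gs \<alpha>"
  have \<alpha>: "natural_family M N \<alpha>" and Gs: "\<And>G. G \<in> set Gs \<Longrightarrow> symmetric_functor M N G"
    and \<sigma>: "any_map \<sigma> (length Gs)" and tsource_\<alpha>: "tsource \<alpha> = map ((!) Gs) \<sigma>"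
    using act by (auto simp: actable_internal_hom_iff)
  have tsource_\<gamma>: "tsource \<gamma> = Gs" and ttarget_\<gamma>: "ttarget \<gamma> = ttarget \<alpha>"
    by (simp_all add: \<gamma>_def)
  have \<gamma>: "component \<gamma> A = act N \<sigma> (map (\<lambda>G. on_obj G A) Gs) (component \<alpha> A)"
    if "A \<in> objs M" for A
    using that by (simp add: \<gamma>_def)
  note actN = actable_component[OF act]
  have source_\<gamma>: "source N (component \<gamma> A) = map (\<lambda>G. on_obj G A) Gs" if "A \<in> objs M" for A
    using N.source_act[OF actN[OF that]] by (simp add: \<gamma> that)
  have \<gamma>_arr: "component \<gamma> A \<in> arrs N" if "A \<in> objs M" for A
    using N.act_arr[OF actN[OF that]] by (simp add: \<gamma> that)
  have natural: "mcomp N (on_arr (ttarget \<alpha>) f) (map (component \<gamma>) (source M f)) =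
      act N (transp_map (length Gs) (length (source M f)))
        (concat (map (\<lambda>A. map (\<lambda>F. on_obj F A) Gs) (source M f)))
        (mcomp N (component \<gamma> (target M f)) (map (\<lambda>F. on_arr F f) Gs))"
    if f: "f \<in> arrs M" for f
  proof -
    define As where "As = source M f"
    define A where "A = target M f"
    define Ff where "Ff = on_arr (ttarget \<alpha>) f"
    define l where "l = length Gs"
    define m where "m = length As"
    define X where "X = mcomp N (component \<alpha> A) (map (\<lambda>F. on_arr F f) (tsource \<alpha>))"
    define Bs where "Bs = concat (map (\<lambda>B. map (\<lambda>F. on_obj F B) (tsource \<alpha>)) As)"
    define Cs where "Cs = concat (map (\<lambda>B. map (\<lambda>G. on_obj G B) Gs) As)"
    define gs where "gs = map (\<lambda>G. on_arr G f) Gs"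
    define \<tau> where "\<tau> = transp_map (length \<sigma>) m"
    have As: "B \<in> objs M" if "B \<in> set As" for B
      using that M.source_objs[OF f] by (auto simp: As_def)
    have A: "A \<in> objs M"
      unfolding A_def using f by (rule M.target_objs)
    have comp_F: "composable N Ff (map (component \<alpha>) As)"
      unfolding As_def Ff_def using \<alpha> f M.source_objs[OF f] by (rule composable_functor_components)
    have natural_\<alpha>: "mcomp N Ff (map (component \<alpha>) As) = act N \<tau> Bs X"
      using natural_family_natural[OF \<alpha> f]
      by (simp add: Ff_def As_def \<tau>_def m_def Bs_def X_def A_def tsource_\<alpha> comp_def)
    have actable_X: "actable any_map N \<tau> Bs X"
      using actable_transp_map[of "component \<alpha> A" f "tsource \<alpha>"]
        natural_family_component[OF \<alpha> A] natural_family_functor(1)[OF \<alpha>] f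
      by (simp add: tsource_\<alpha> A_def \<tau>_def m_def Bs_def X_def As_def)
    have actable_gs: "actable any_map N (transp_map l m) Cs (mcomp N (component \<gamma> A) gs)"
      unfolding l_def m_def Cs_def gs_def As_def
      by (rule actable_transp_map) (use \<gamma>_arr source_\<gamma> A Gs f in \<open>auto simp: A_def\<close>)
    have comp_gs: "composable N (component \<gamma> A) gs"
      unfolding gs_def
      by (rule composable_arr_functors[where M = M]) (use \<gamma>_arr source_\<gamma> A Gs f in \<open>auto simp: A_def\<close>)
    then have gs: "set gs \<subseteq> arrs N" "map (target N) gs = map (\<lambda>G. on_obj G A) Gs"
      using source_\<gamma>[OF A] by (auto simp: composable_def)
    define J where "J = juxt (map (\<lambda>_. \<sigma>) [0..<m]) (map (\<lambda>_. l) [0..<m])"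
    define B where "B = block_map \<sigma> (map (\<lambda>_. m) [0..<l])"
    have J: "J = juxt (map (\<lambda>_. \<sigma>) As) (map (length \<circ> (\<lambda>B. map (\<lambda>G. on_obj G B) Gs)) As)"
      by (simp add: J_def m_def l_def comp_def map_replicate_const)
    have gs_\<sigma>: "map ((!) gs) \<sigma> = map (\<lambda>F. on_arr F f) (tsource \<alpha>)"
      using \<sigma> by (auto simp: gs_def tsource_\<alpha> any_map_def)
    \<comment> \<open>Each \<open>on_arr G f\<close> has as many sources as \<open>f\<close>, so all
      blocks moved by \<sigma> have the same size \<open>m\<close>.\<close>
    have B: "B = block_map \<sigma> (map (length \<circ> source N) gs)"
    proof -
      have "map (length \<circ> source N) gs = map (\<lambda>_. m) Gs"
        using symmetric_functor_arr(2)[OF Gs f] by (simp add: gs_def m_def As_def)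
      then show ?thesis
        by (simp add: B_def l_def map_replicate_const)
    qed
    have "mcomp N Ff (map (component \<gamma>) As) =
        mcomp N Ff (map (\<lambda>B. act N \<sigma> (map (\<lambda>G. on_obj G B) Gs) (component \<alpha> B)) As)"
      using \<gamma>[OF As] by (simp cong: map_cong)
    also have "\<dots> = act N J Cs (mcomp N Ff (map (component \<alpha>) As))"
      unfolding J Cs_def by (rule N.mcomp_act_map[OF comp_F]) (rule actN[OF As])
    also have "\<dots> = act N J Cs (act N \<tau> Bs X)"
      by (simp only: natural_\<alpha>)
    also have "\<dots> = act N (map_comp J \<tau>) Cs X"
    proof (rule N.act_comp[OF actable_X])
      show "actable any_map N J Cs (act N \<tau> Bs X)"
        unfolding natural_\<alpha>[symmetric] J Cs_def
        by (rule N.actable_juxt_map[OF comp_F]) (rule actN[OF As])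
    qed
    also have "map_comp J \<tau> = map_comp (transp_map l m) B"
      unfolding J_def \<tau>_def B_def by (rule juxt_transp_map) (simp add: l_def \<sigma>)
    \<comment> \<open>This link is computed from its right-hand side: selecting \<open>gs\<close>
      along \<sigma> gives the images of \<open>f\<close> under the source functors of \<alpha>, so
      \<open>act_mcomp\<close> produces \<open>X\<close>.\<close>
    also have "act N (map_comp (transp_map l m) B) Cs X =
        act N (transp_map l m) Cs (mcomp N (component \<gamma> A) gs)"
    proof -
      have eq: "mcomp N (component \<gamma> A) gs = act N B (concat (map (source N) gs)) X"
        using N.act_mcomp[OF actN[OF A]] comp_gs by (simp add: \<gamma>[OF A] B X_def gs_\<sigma>)
      have "actable any_map N B (concat (map (source N) gs)) X"
        using N.actable_block_map[OF actN[OF A] gs] by (simp add: B X_def gs_\<sigma>)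
      then show ?thesis
        unfolding eq by (rule N.act_comp[symmetric]) (use actable_gs in \<open>simp add: eq\<close>)
    qed
    finally show ?thesis
      by (simp add: Ff_def As_def A_def l_def m_def Cs_def gs_def)
  qed
  have "component \<gamma> \<in> objs M \<rightarrow>\<^sub>E arrs N"
    using \<gamma>_arr by (auto simp: \<gamma>_def)
  moreover have "target N (component \<gamma> A) = on_obj (ttarget \<alpha>) A" if "A \<in> objs M" for A
    using N.target_act[OF actN[OF that]] natural_family_component(3)[OF \<alpha> that] that
    by (simp add: \<gamma>)
  ultimately have "natural_family M N \<gamma>"
    using Gs natural_family_functor(2)[OF \<alpha>] source_\<gamma> natural
    by (simp add: natural_family_def ttarget_\<gamma> tsource_\<gamma>)
  then show ?thesis
    by (simp only: \<gamma>_def)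
qed

text \<open>The closure axioms are the naturality lemmas. In each equation sources and targets match
  by computation, and components match by the same axiom of \<open>N\<close>.\<close>

lemma cartesian_multicategory_internal_hom: "cartesian_multicategory (internal_hom M N)"
proof (intro cartesian_multicategory.intro acted_multicategory.intro
    multicategory.intro acted_multicategory_axioms.intro)
  let ?H = "internal_hom M N"
  fix \<alpha> assume "\<alpha> \<in> arrs ?H"
  then have \<alpha>: "natural_family M N \<alpha>" by simp
  show "set (source ?H \<alpha>) \<subseteq> objs ?H" "target ?H \<alpha> \<in> objs ?H"
    using natural_family_functor[OF \<alpha>] by auto
  show "mcomp ?H (ident ?H (target ?H \<alpha>)) [\<alpha>] = \<alpha>"
    using natural_family_extensional[OF \<alpha>] natural_family_component[OF \<alpha>]
    by (intro mtrans_eqI[where X = "objs M"])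
       (auto simp flip: natural_family_component(3)[OF \<alpha>] intro: N.ident_left)
  show "mcomp ?H \<alpha> (map (ident ?H) (source ?H \<alpha>)) = \<alpha>"
  proof (rule mtrans_eqI[where X = "objs M"])
    fix A assume A: "A \<in> objs M"
    then show "component (mcomp ?H \<alpha> (map (ident ?H) (source ?H \<alpha>))) A = component \<alpha> A"
      using N.ident_right[of "component \<alpha> A"] natural_family_component[OF \<alpha> A]
      by (simp add: comp_def)
  qed (use natural_family_extensional[OF \<alpha>] in \<open>auto simp: comp_def\<close>)
  show "act ?H [0..<length (source ?H \<alpha>)] (source ?H \<alpha>) \<alpha> = \<alpha>"
  proof (rule mtrans_eqI[where X = "objs M"])
    fix A assume A: "A \<in> objs M"
    then show "component (act ?H [0..<length (source ?H \<alpha>)] (source ?H \<alpha>) \<alpha>) A = component \<alpha> A"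
      using N.act_id[of "component \<alpha> A"] natural_family_component[OF \<alpha> A] by simp
  qed (use natural_family_extensional[OF \<alpha>] in auto)
next
  let ?H = "internal_hom M N"
  fix F assume "F \<in> objs ?H"
  then show "ident ?H F \<in> arrs ?H" "source ?H (ident ?H F) = [F]" "target ?H (ident ?H F) = F"
    using natural_family_ident[of F] by simp_all
next
  let ?H = "internal_hom M N"
  fix \<alpha> \<beta>s assume comp: "composable ?H \<alpha> \<beta>s"
  show "mcomp ?H \<alpha> \<beta>s \<in> arrs ?H"
    using natural_family_mcomp[OF comp] by simp
  show "source ?H (mcomp ?H \<alpha> \<beta>s) = concat (map (source ?H) \<beta>s)"
    "target ?H (mcomp ?H \<alpha> \<beta>s) = target ?H \<alpha>"
    by simp_all
  show "mcomp ?H (mcomp ?H \<alpha> \<beta>s) (concat \<gamma>ss) = mcomp ?H \<alpha> (map2 (mcomp ?H) \<beta>s \<gamma>ss)"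
    if comps: "list_all2 (composable ?H) \<beta>s \<gamma>ss" for \<gamma>ss
  proof (rule mtrans_eqI[where X = "objs M"])
    show "tsource (mcomp ?H (mcomp ?H \<alpha> \<beta>s) (concat \<gamma>ss)) =
        tsource (mcomp ?H \<alpha> (map2 (mcomp ?H) \<beta>s \<gamma>ss))"
      using list_all2_lengthD[OF comps]
      by (induction \<beta>s \<gamma>ss rule: list_induct2) auto
    fix A assume A: "A \<in> objs M"
    let ?at = "\<lambda>\<beta>. component \<beta> A"
    have "list_all2 (composable N) (map ?at \<beta>s) (map (map ?at) \<gamma>ss)"
      using comps composable_component[where M = M and N = N and A = A] A by (auto simp: list_all2_conv_all_nth)
    moreover have "map2 (mcomp N) (map ?at \<beta>s) (map (map ?at) \<gamma>ss) =
        map ?at (map2 (mcomp ?H) \<beta>s \<gamma>ss)"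
      using list_all2_lengthD[OF comps] A by (induction \<beta>s \<gamma>ss rule: list_induct2) auto
    ultimately show "component (mcomp ?H (mcomp ?H \<alpha> \<beta>s) (concat \<gamma>ss)) A =
        component (mcomp ?H \<alpha> (map2 (mcomp ?H) \<beta>s \<gamma>ss)) A"
      using N.mcomp_assoc[OF composable_component[OF comp A]] A by (simp add: map_concat)
  qed simp_all
next
  let ?H = "internal_hom M N"
  fix \<sigma> Gs \<alpha> assume act: "actable any_map ?H \<sigma> Gs \<alpha>"
  show "act ?H \<sigma> Gs \<alpha> \<in> arrs ?H"
    using natural_family_act[OF act] by simp
  show "source ?H (act ?H \<sigma> Gs \<alpha>) = Gs" "target ?H (act ?H \<sigma> Gs \<alpha>) = target ?H \<alpha>"
    by simp_all
  show "act ?H \<rho> Ks (act ?H \<sigma> Gs \<alpha>) = act ?H (map_comp \<rho> \<sigma>) Ks \<alpha>"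
    if act': "actable any_map ?H \<rho> Ks (act ?H \<sigma> Gs \<alpha>)" for \<rho> Ks
  proof (rule mtrans_eqI[where X = "objs M"])
    fix A assume A: "A \<in> objs M"
    show "component (act ?H \<rho> Ks (act ?H \<sigma> Gs \<alpha>)) A = component (act ?H (map_comp \<rho> \<sigma>) Ks \<alpha>) A"
      using N.act_comp[OF actable_component[OF act A]] actable_component[OF act' A] A by simp
  qed simp_all
  show "mcomp ?H (act ?H \<sigma> Gs \<alpha>) \<beta>s =
      act ?H (block_map \<sigma> (map (length \<circ> source ?H) \<beta>s)) (concat (map (source ?H) \<beta>s))
        (mcomp ?H \<alpha> (map ((!) \<beta>s) \<sigma>))"
    if comp: "composable ?H (act ?H \<sigma> Gs \<alpha>) \<beta>s" for \<beta>s
  proof (rule mtrans_eqI[where X = "objs M"])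
    fix A assume A: "A \<in> objs M"
    let ?at = "\<lambda>\<beta>. component \<beta> A"
    have \<beta>s: "natural_family M N \<beta>" if "\<beta> \<in> set \<beta>s" for \<beta>
      using comp that unfolding composable_internal_hom_iff by blast
    have "map ttarget \<beta>s = Gs"
      using comp by (simp add: composable_internal_hom_iff)
    then have "length Gs = length \<beta>s"
      by auto
    \<comment> \<open>Selecting along \<sigma> commutes with evaluation at \<open>A\<close> because
      the values of \<sigma> are places of \<open>\<beta>s\<close>; the equality of lengths provides
      this bound.\<close>
    then have \<sigma>: "map ((!) (map ?at \<beta>s)) \<sigma> = map ?at (map ((!) \<beta>s) \<sigma>)"
      using act by (auto simp: actable_internal_hom_iff any_map_def)
    have source: "map (source N) (map ?at \<beta>s) = map (map (\<lambda>G. on_obj G A)) (map tsource \<beta>s)"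
      using natural_family_component(2)[OF \<beta>s A] by simp
    then have "map length (map (source N) (map ?at \<beta>s)) = map (length \<circ> tsource) \<beta>s"
      by (simp only: map_map) simp
    then have lengths: "map (length \<circ> source N) (map ?at \<beta>s) = map (length \<circ> tsource) \<beta>s"
      by simp
    have "component (mcomp ?H (act ?H \<sigma> Gs \<alpha>) \<beta>s) A =
        mcomp N (act N \<sigma> (map (\<lambda>G. on_obj G A) Gs) (component \<alpha> A)) (map ?at \<beta>s)"
      using A by simp
    also have "\<dots> = act N (block_map \<sigma> (map (length \<circ> tsource) \<beta>s))
        (concat (map (map (\<lambda>G. on_obj G A)) (map tsource \<beta>s)))
        (mcomp N (component \<alpha> A) (map ?at (map ((!) \<beta>s) \<sigma>)))"
      unfolding \<sigma>[symmetric] source[symmetric] lengths[symmetric]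
      by (rule N.act_mcomp[OF actable_component[OF act A]])
         (use composable_component[OF comp A] A in simp)
    also have "\<dots> = component (act ?H (block_map \<sigma> (map (length \<circ> source ?H) \<beta>s))
        (concat (map (source ?H) \<beta>s)) (mcomp ?H \<alpha> (map ((!) \<beta>s) \<sigma>))) A"
      using A by (simp add: map_concat)
    finally show "component (mcomp ?H (act ?H \<sigma> Gs \<alpha>) \<beta>s) A =
        component (act ?H (block_map \<sigma> (map (length \<circ> source ?H) \<beta>s))
          (concat (map (source ?H) \<beta>s)) (mcomp ?H \<alpha> (map ((!) \<beta>s) \<sigma>))) A" .
  qed simp_all
next
  let ?H = "internal_hom M N"
  fix \<alpha> \<beta>s \<sigma>s Bss
  assume comp: "composable ?H \<alpha> \<beta>s"
    and lens: "length \<sigma>s = length \<beta>s" "length Bss = length \<beta>s"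
    and act: "\<And>i. i < length \<beta>s \<Longrightarrow> actable any_map ?H (\<sigma>s ! i) (Bss ! i) (\<beta>s ! i)"
  show "mcomp ?H \<alpha> (map (\<lambda>i. act ?H (\<sigma>s ! i) (Bss ! i) (\<beta>s ! i)) [0..<length \<beta>s]) =
    act ?H (juxt \<sigma>s (map length Bss)) (concat Bss) (mcomp ?H \<alpha> \<beta>s)"
  proof (rule mtrans_eqI[where X = "objs M"])
    show "tsource (mcomp ?H \<alpha> (map (\<lambda>i. act ?H (\<sigma>s ! i) (Bss ! i) (\<beta>s ! i)) [0..<length \<beta>s])) =
        tsource (act ?H (juxt \<sigma>s (map length Bss)) (concat Bss) (mcomp ?H \<alpha> \<beta>s))"
      by (simp add: comp_def map_nth flip: lens(2))
    fix A assume A: "A \<in> objs M"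
    let ?\<beta>s = "map (\<lambda>\<beta>. component \<beta> A) \<beta>s" and ?Bss = "map (map (\<lambda>G. on_obj G A)) Bss"
    let ?acted = "map (\<lambda>i. act ?H (\<sigma>s ! i) (Bss ! i) (\<beta>s ! i)) [0..<length \<beta>s]"
    have "component (mcomp ?H \<alpha> ?acted) A =
        mcomp N (component \<alpha> A) (map (\<lambda>\<beta>. component \<beta> A) ?acted)"
      using A by simp
    also have "map (\<lambda>\<beta>. component \<beta> A) ?acted =
        map (\<lambda>i. act N (\<sigma>s ! i) (?Bss ! i) (?\<beta>s ! i)) [0..<length ?\<beta>s]"
      using A lens by simp
    also have "mcomp N (component \<alpha> A) \<dots> =
        act N (juxt \<sigma>s (map length ?Bss)) (concat ?Bss) (mcomp N (component \<alpha> A) ?\<beta>s)"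
      by (rule N.mcomp_act[OF composable_component[OF comp A]])
         (use lens actable_component[OF act A] in auto)
    also have "\<dots> = component (act ?H (juxt \<sigma>s (map length Bss)) (concat Bss) (mcomp ?H \<alpha> \<beta>s)) A"
      using A by (simp add: map_concat comp_def)
    finally show "component (mcomp ?H \<alpha> ?acted) A =
        component (act ?H (juxt \<sigma>s (map length Bss)) (concat Bss) (mcomp ?H \<alpha> \<beta>s)) A" .
  qed simp_all
qed

end

theorem proposition4p18:
  fixes M :: "('o, 'a) acted_multicat" and N :: "('p, 'b) acted_multicat"
  assumes "symmetric_multicategory M" and "cartesian_multicategory N"
  shows "cartesian_multicategory (internal_hom M N) \<and>
    (\<forall>\<sigma> Gs \<alpha>. actable any_map (internal_hom M N) \<sigma> Gs \<alpha> \<longrightarrow>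
      (\<forall>A \<in> objs M. component (act (internal_hom M N) \<sigma> Gs \<alpha>) A =
        act N \<sigma> (map (\<lambda>G. on_obj G A) Gs) (component \<alpha> A)))"
proof -
  interpret functor_multicategory M N
    using assms by (simp add: functor_multicategory_def cartesian_multicategory_def)
  \<comment> \<open>The second conjunct is how \<open>internal_hom\<close> defines its action on
    components.\<close>
  show ?thesis
    using cartesian_multicategory_internal_hom by simp
qed

end
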